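(* Let $\mathcal P$ be the set of all integer partitions (including the empty partition $\emptyset$) and let $F\colon\mathcal P\to\mathbb C$ be arbitrary. Then, as formal power series in $q$, \[\langle F\rangle_q=\sum_{\lambda\in\mathcal P}f(\lambda)q^{|\lambda|},\qquad\text{where}\quad f(\lambda)=\sum_{\delta\mid\lambda}F(\delta)\,\mu_{\mathcal P}(\lambda/\delta).\]
   Context: For a partition $\lambda$, $|\lambda|$ is the sum of its parts and $\ell(\lambda)$ its number of parts. A partition $\delta$ divides $\lambda$ (written $\delta\mid\lambda$) if every part of $\delta$ is a part of $\lambda$, counted with multiplicity (so $\emptyset$ and $\lambda$ divide $\lambda$); in that case $\lambda/\delta$ is the partition obtained by deleting the parts of $\delta$ from $\lambda$. The partition M\"obius function is $\mu_{\mathcal P}(\emptyset)=1$, $\mu_{\mathcal P}(\lambda)=0$ if $\lambda$ has a repeated part, and $\mu_{\mathcal P}(\lambda)=(-1)^{\ell(\lambda)}$ otherwise. The $q$-bracket of $F$ is the formal power series $\langle F\rangle_q:=(q;q)_\infty\sum_{\lambda\in\mathcal P}F(\lambda)q^{|\lambda|}$, where $(q;q)_\infty=\prod_{n\ge1}(1-q^n)$; a series $\sum_{\lambda}f(\lambda)q^{|\lambda|}$ means the power series whose coefficient of $q^n$ is $\sum_{|\lambda|=n}f(\lambda)$. *)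

theory Defs
  imports
    "HOL-Library.Multiset"
    "HOL-Computational_Algebra.Formal_Power_Series"
    "HOL-Analysis.Infinite_Products"
begin

text \<open>
  A partition is the finite multiset of its (positive) parts.  Thus its size \<open>|\<nu>|\<close> is
  \<open>sum_mset \<nu>\<close>, and its number of parts \<open>\<ell>(\<nu>)\<close>, counted with multiplicity, is \<open>size \<nu>\<close>.
\<close>

definition partitions :: "nat multiset set" where
  "partitions = {\<nu>. 0 \<notin># \<nu>}"

definition partition_dvd :: "nat multiset \<Rightarrow> nat multiset \<Rightarrow> bool" where
  "partition_dvd \<delta> \<nu> \<longleftrightarrow> \<delta> \<in> partitions \<and> \<delta> \<subseteq># \<nu>"

definition partition_quot :: "nat multiset \<Rightarrow> nat multiset \<Rightarrow> nat multiset" where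
  "partition_quot \<nu> \<delta> = \<nu> - \<delta>"

definition partition_moebius :: "nat multiset \<Rightarrow> complex" where
  "partition_moebius \<nu> =
     (if \<nu> = {#} then 1
      else if \<exists>k. count \<nu> k \<ge> 2 then 0
      else (-1) ^ size \<nu>)"

text \<open>The series \<open>\<Sum>\<^sub>\<nu> f(\<nu>) q\<^sup>|\<^sup>\<nu>\<^sup>|\<close>; its coefficients are finite sums by the lemma below.\<close>

definition partition_series :: "(nat multiset \<Rightarrow> complex) \<Rightarrow> complex fps" where
  "partition_series f = Abs_fps (\<lambda>n. \<Sum>\<nu> | \<nu> \<in> partitions \<and> sum_mset \<nu> = n. f \<nu>)"

text \<open>
  The product \<open>(q;q)\<^sub>\<infinity>\<close>, taken with respect to the usual (\<open>q\<close>-adic) topology on formal power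
  series; the index is shifted, since \<^const>\<open>prodinf\<close> starts at 0.
\<close>

definition euler_product :: "complex fps" where
  "euler_product = prodinf (\<lambda>n. 1 - fps_X ^ Suc n)"

definition q_bracket :: "(nat multiset \<Rightarrow> complex) \<Rightarrow> complex fps" where
  "q_bracket F = euler_product * partition_series F"

lemma finite_partitions_of: "finite {\<nu>. \<nu> \<in> partitions \<and> sum_mset \<nu> = n}"
proof -
  have size_le: "size \<nu> \<le> sum_mset \<nu>" if "0 \<notin># \<nu>" for \<nu> :: "nat multiset"
    using that by (induction \<nu>) auto
  have "{\<nu>. \<nu> \<in> partitions \<and> sum_mset \<nu> = n}
          \<subseteq> mset ` {xs. set xs \<subseteq> {..n} \<and> length xs \<le> n}"
  proof
    fix \<nu> assume \<nu>: "\<nu> \<in> {\<nu>. \<nu> \<in> partitions \<and> sum_mset \<nu> = n}"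
    obtain xs where xs: "\<nu> = mset xs"
      by (metis ex_mset)
    have "x \<le> n" if "x \<in> set xs" for x
      using \<nu> xs that member_le_sum_list[of x xs] by (simp add: sum_mset_sum_list)
    moreover have "length xs \<le> n"
      using size_le[of \<nu>] \<nu> xs by (simp add: partitions_def)
    ultimately show "\<nu> \<in> mset ` {xs. set xs \<subseteq> {..n} \<and> length xs \<le> n}"
      using xs by auto
  qed
  thus ?thesis
    by (rule finite_subset) (intro finite_imageI finite_lists_length_le finite_atMost)
qed

lemma finite_partition_divisors: "finite {\<delta>. partition_dvd \<delta> \<nu>}"
proof (rule finite_subset)
  show "{\<delta>. partition_dvd \<delta> \<nu>} \<subseteq> mset ` {xs. set xs \<subseteq> set_mset \<nu> \<and> length xs \<le> size \<nu>}"
  proof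
    fix \<delta> assume "\<delta> \<in> {\<delta>. partition_dvd \<delta> \<nu>}"
    hence "\<delta> \<subseteq># \<nu>" by (simp add: partition_dvd_def)
    moreover obtain xs where "\<delta> = mset xs"
      by (metis ex_mset)
    ultimately show "\<delta> \<in> mset ` {xs. set xs \<subseteq> set_mset \<nu> \<and> length xs \<le> size \<nu>}"
      using set_mset_mono[of \<delta> \<nu>] size_mset_mono[of \<delta> \<nu>] by auto
  qed
qed (intro finite_imageI finite_lists_length_le finite_set_mset)

lemma has_prod_euler_product: "(\<lambda>n. 1 - fps_X ^ Suc n) has_prod euler_product"
proof -
  define P :: "nat \<Rightarrow> complex fps" where "P = (\<lambda>m. \<Prod>i\<le>m. 1 - fps_X ^ Suc i)"
  have step: "fps_nth (P (Suc m)) n = fps_nth (P m) n" if "n \<le> m" for m n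
  proof -
    have "P (Suc m) = P m - P m * fps_X ^ Suc (Suc m)"
      unfolding P_def prod.atMost_Suc right_diff_distrib mult_1_right ..
    moreover have "fps_nth (P m * fps_X ^ Suc (Suc m)) n = 0"
      unfolding fps_X_power_mult_right_nth using that by simp
    ultimately show ?thesis by simp
  qed
  have stable: "fps_nth (P m) n = fps_nth (P n) n" if "n \<le> m" for m n
    using that by (induction m rule: dec_induct) (auto simp: step)
  define L where "L = Abs_fps (\<lambda>n. fps_nth (P n) n)"
  have "P \<longlonglongrightarrow> L"
  proof (rule tendsto_fpsI)
    show "eventually (\<lambda>m. fps_nth (P m) n = fps_nth L n) sequentially" for n
      using eventually_ge_at_top[of n] by eventually_elim (unfold L_def fps_nth_Abs_fps, rule stable)
  qed
  moreover have "fps_nth L 0 = 1"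
    unfolding L_def P_def fps_nth_Abs_fps by simp
  hence "L \<noteq> 0" by auto
  ultimately have "raw_has_prod (\<lambda>n. 1 - fps_X ^ Suc n) 0 L"
    unfolding raw_has_prod_def P_def add_0_right by blast
  hence "(\<lambda>n. 1 - fps_X ^ Suc n) has_prod L"
    unfolding has_prod_def by blast
  thus ?thesis
    unfolding euler_product_def by (metis has_prod_unique)
qed

end

theory Submission
  imports Defs
begin

text \<open>Expanding \<open>(q;q)_\<infinity>\<close> means choosing from each factor either 1 or
  the term -q^i. A finite choice is a set of distinct parts with sign (-1)^(number of parts), so the
  product is the partition series of \<open>partition_moebius\<close>
  (\<open>euler_product_eq_partition_series\<close>). Partition series multiply by a convolution
  over divisors (\<open>partition_series_mult\<close>), as Dirichlet series do, with multiset union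
  in the role of multiplication. Applying this to \<open>F\<close> and
  \<open>partition_moebius\<close> gives the formula.\<close>

lemma partition_series_mult:
  "partition_series f * partition_series g =
     partition_series (\<lambda>\<nu>. \<Sum>\<delta> | partition_dvd \<delta> \<nu>. f \<delta> * g (partition_quot \<nu> \<delta>))"
proof (rule fps_ext)
  fix n
  define A where "A k = {\<nu>. \<nu> \<in> partitions \<and> sum_mset \<nu> = k}" for k :: nat
  have fin: "finite (A k)" for k
    unfolding A_def by (rule finite_partitions_of)
  have mono: "sum_mset \<delta> \<le> sum_mset \<nu>" if "\<delta> \<subseteq># \<nu>" for \<delta> \<nu> :: "nat multiset"
    using that by (auto simp: mset_subset_eq_exists_conv)
  have "fps_nth (partition_series f * partition_series g) n =
      (\<Sum>k=0..n. \<Sum>(\<delta>, \<epsilon>)\<in>A k \<times> A (n - k). f \<delta> * g \<epsilon>)"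
    by (simp add: fps_mult_nth partition_series_def A_def sum_product sum.cartesian_product)
  also have "\<dots> = (\<Sum>(k, \<delta>, \<epsilon>)\<in>(SIGMA k:{0..n}. A k \<times> A (n - k)). f \<delta> * g \<epsilon>)"
    by (subst sum.Sigma) (auto simp: fin)
  \<comment> \<open>A pair of partitions is the same as its union together with a divisor of it. The
    index \<open>k\<close> is recovered as the size of \<open>\<delta>\<close>, and
    \<open>mono\<close> keeps it within \<open>{0..n}\<close>.\<close>
  also have "\<dots> = (\<Sum>(\<nu>, \<delta>)\<in>(SIGMA \<nu>:A n. {\<delta>. partition_dvd \<delta> \<nu>}). f \<delta> * g (partition_quot \<nu> \<delta>))"
    by (rule sum.reindex_bij_witness[where
          i = "\<lambda>(\<nu>, \<delta>). (sum_mset \<delta>, \<delta>, \<nu> - \<delta>)" and j = "\<lambda>(k, \<delta>, \<epsilon>). (\<delta> + \<epsilon>, \<delta>)"])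
       (auto simp: A_def partition_dvd_def partition_quot_def partitions_def sum_mset_diff mono
          dest: in_diffD)
  also have "\<dots> = (\<Sum>\<nu>\<in>A n. \<Sum>\<delta> | partition_dvd \<delta> \<nu>. f \<delta> * g (partition_quot \<nu> \<delta>))"
    by (subst sum.Sigma) (auto simp: fin finite_partition_divisors)
  finally show "fps_nth (partition_series f * partition_series g) n =
      fps_nth (partition_series (\<lambda>\<nu>. \<Sum>\<delta> | partition_dvd \<delta> \<nu>. f \<delta> * g (partition_quot \<nu> \<delta>))) n"
    by (simp add: partition_series_def A_def)
qed

lemma prod_one_minus_fps_X_power:
  fixes A :: "nat set"
  assumes "finite A"
  shows "(\<Prod>i\<in>A. 1 - fps_X ^ i :: 'a :: comm_ring_1 fps) =
    (\<Sum>S\<in>Pow A. (-1) ^ card S * fps_X ^ \<Sum>S)"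
  using prod_diff_conv_sum[OF assms, of "\<lambda>_. 1" "\<lambda>i. fps_X ^ i :: 'a fps"]
  by (simp add: power_sum)

lemma partition_moebius_mset_set:
  "finite S \<Longrightarrow> partition_moebius (mset_set S) = (-1) ^ card S"
  by (auto simp: partition_moebius_def count_mset_set' mset_set_empty_iff)

text \<open>A nonzero value rules out repeated parts, so the partition is determined by its set of
  parts.\<close>

lemma partition_moebius_nonzero_imp_mset_set:
  assumes "partition_moebius \<nu> \<noteq> 0"
  shows "\<nu> = mset_set (set_mset \<nu>)"
proof (rule multiset_eqI)
  fix k
  have "count \<nu> k < 2"
    using assms by (auto simp: partition_moebius_def not_le split: if_splits)
  moreover have "count \<nu> k > 0 \<longleftrightarrow> k \<in># \<nu>" by simp
  ultimately show "count \<nu> k = count (mset_set (set_mset \<nu>)) k"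
    by (cases "count \<nu> k") (auto simp: count_mset_set' not_in_iff)
qed

text \<open>Factors with i > n cannot affect the coefficient of q^n, so any \<open>m\<close> \<ge>
  \<open>n\<close> is enough. The surviving subsets of \<open>{1..m}\<close> are exactly the
  partitions of \<open>n\<close> into distinct parts.\<close>

lemma fps_nth_prod_one_minus_fps_X_power:
  assumes "n \<le> m"
  shows "fps_nth (\<Prod>i=1..m. 1 - fps_X ^ i) n = fps_nth (partition_series partition_moebius) n"
proof -
  have "fps_nth (\<Prod>i=1..m. 1 - fps_X ^ i) n =
      (\<Sum>S\<in>Pow {1..m}. if \<Sum>S = n then (-1) ^ card S else 0 :: complex)"
    unfolding prod_one_minus_fps_X_power[OF finite_atLeastAtMost] fps_sum_nth
    \<comment> \<open>The sign is itself a power series here; splitting on parity makes it 1 or -1,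
      so that the coefficient can be read off.\<close>
    by (intro sum.cong refl) (auto simp: minus_one_power_iff fps_X_power_nth)
  also have "\<dots> = (\<Sum>S | S \<subseteq> {1..m} \<and> \<Sum>S = n. (-1) ^ card S)"
    by (intro sum.mono_neutral_cong_right) auto
  also have "\<dots> = (\<Sum>\<nu> | \<nu> \<in> partitions \<and> sum_mset \<nu> = n \<and> partition_moebius \<nu> \<noteq> 0. partition_moebius \<nu>)"
  proof (rule sum.reindex_bij_witness[where i = set_mset and j = mset_set])
    fix S assume "S \<in> {S. S \<subseteq> {1..m} \<and> \<Sum>S = n}"
    then have S: "S \<subseteq> {1..m}" "\<Sum>S = n" and fin: "finite S"
      by (auto intro: finite_subset)
    then show "set_mset (mset_set S) = S" "partition_moebius (mset_set S) = (-1) ^ card S"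
      "mset_set S \<in> {\<nu>. \<nu> \<in> partitions \<and> sum_mset \<nu> = n \<and> partition_moebius \<nu> \<noteq> 0}"
      by (auto simp: partition_moebius_mset_set partitions_def sum_unfold_sum_mset)
  next
    fix \<nu> assume "\<nu> \<in> {\<nu>. \<nu> \<in> partitions \<and> sum_mset \<nu> = n \<and> partition_moebius \<nu> \<noteq> 0}"
    then have \<nu>: "\<nu> \<in> partitions" "sum_mset \<nu> = n" and eq: "mset_set (set_mset \<nu>) = \<nu>"
      using partition_moebius_nonzero_imp_mset_set[of \<nu>] by auto
    then have sum: "\<Sum>(set_mset \<nu>) = n"
      by (simp add: sum_unfold_sum_mset)
    \<comment> \<open>A part is positive and at most the total \<open>n\<close>, hence at most
      \<open>m\<close>.\<close>
    have "k \<in> {1..m}" if "k \<in># \<nu>" for k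
      using member_le_sum[of k "set_mset \<nu>" "\<lambda>x. x"] that sum \<nu>(1) assms
      by (cases k) (auto simp: partitions_def)
    with sum show "set_mset \<nu> \<in> {S. S \<subseteq> {1..m} \<and> \<Sum>S = n}" by blast
    show "mset_set (set_mset \<nu>) = \<nu>" by (rule eq)
  qed
  also have "\<dots> = (\<Sum>\<nu> | \<nu> \<in> partitions \<and> sum_mset \<nu> = n. partition_moebius \<nu>)"
    by (rule sum.mono_neutral_left[OF finite_partitions_of]) auto
  finally show ?thesis by (simp add: partition_series_def)
qed

text \<open>Each coefficient of the partial products is eventually that of the Moebius series, so
  they converge to it q-adically; limits are unique.\<close>

lemma euler_product_eq_partition_series: "euler_product = partition_series partition_moebius"
proof -
  have *: "(\<lambda>m. \<Prod>i\<le>m. 1 - fps_X ^ Suc i) \<longlonglongrightarrow> euler_product"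
    by (rule has_prod_imp_tendsto[OF has_prod_euler_product])
  have "(\<lambda>m. \<Prod>i\<le>m. 1 - fps_X ^ Suc i) \<longlonglongrightarrow> partition_series partition_moebius"
  proof (rule tendsto_fpsI)
    fix n
    have eq: "(\<Prod>i\<le>m. 1 - fps_X ^ Suc i) = (\<Prod>i=1..Suc m. 1 - fps_X ^ i :: complex fps)" for m
      by (simp only: atMost_atLeast0 prod.shift_bounds_cl_Suc_ivl One_nat_def)
    show "eventually (\<lambda>m. fps_nth (\<Prod>i\<le>m. 1 - fps_X ^ Suc i) n =
        fps_nth (partition_series partition_moebius) n) sequentially"
      using eventually_ge_at_top[of n]
      by eventually_elim (unfold eq, rule fps_nth_prod_one_minus_fps_X_power, simp)
  qed
  with * show ?thesis by (rule LIMSEQ_unique)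
qed

theorem theorem3p18:
  fixes F :: "nat multiset \<Rightarrow> complex"
  shows "q_bracket F =
    partition_series (\<lambda>\<nu>. \<Sum>\<delta> | partition_dvd \<delta> \<nu>. F \<delta> * partition_moebius (partition_quot \<nu> \<delta>))"
  unfolding q_bracket_def euler_product_eq_partition_series
  \<comment> \<open>Commuting puts \<open>F\<close> on the divisor and
    \<open>partition_moebius\<close> on the quotient.\<close>
  by (subst mult.commute) (rule partition_series_mult)

end
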